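(* Let $f:\mathbb{R}^n\to\mathbb{R}$ be twice differentiable with $L_H$-Lipschitz Hessian, and partition the variable into blocks $\theta=(\theta_1,\dots,\theta_B)$. Consider the blockwise iteration in which $x_{k+1}$ is obtained from $x_k$ by processing the blocks $b=1,\dots,B$ sequentially: at the current point $\theta$ (after blocks $1,\dots,b-1$ have been processed), let $g_b$ and $H_b$ be the gradient and Hessian at $s=0$ of the block restriction $f_b(s):=f(\theta_1,\dots,\theta_b+s,\dots,\theta_B)$, let $s_b$ be a global minimizer of $$m_b(s)=\langle g_b,s\rangle+\tfrac12\langle H_bs,s\rangle+\tfrac{M_b}{6}\|s\|^3$$ with $M_b>0$, and accept the update $\theta_b\leftarrow\theta_b+s_b$ only if the full loss $f$ does not increase (otherwise leave $\theta_b$ unchanged). Then the iteration is monotone, $f(x_{k+1})\le f(x_k)$ for all $k$, and every accepted block step with $M_b\ge L_{H,b}$, where $L_{H,b}$ is the Lipschitz constant of the Hessian of the block restriction $f_b$ (the other blocks frozen at their current values), satisfies $$m_b(s_b)\le-\tfrac{M_b}{12}\|s_b\|^3\qquad\text{and}\qquad f_b(s_b)\le f_b(0)-\tfrac{M_b}{12}\|s_b\|^3 .$$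
   Context: $L_H$-Lipschitz Hessian means $\|\nabla^2 f(x)-\nabla^2 f(y)\|\le L_H\|x-y\|$ for all $x,y$. Norms are Euclidean for vectors and spectral for matrices. The constants $M_b$ may vary between blocks and iterations. *)

theory Defs
  imports "HOL-Analysis.Analysis"
begin

definition gradient :: "(real ^ 'n \<Rightarrow> real) \<Rightarrow> real ^ 'n \<Rightarrow> real ^ 'n" where
  "gradient f x = (THE g. GDERIV f x :> g)"

definition hessian :: "(real ^ 'n \<Rightarrow> real) \<Rightarrow> real ^ 'n \<Rightarrow> real ^ 'n ^ 'n" where
  "hessian f x = jacobian (gradient f) (at x)"

definition twice_differentiable :: "(real ^ 'n \<Rightarrow> real) \<Rightarrow> bool" where
  "twice_differentiable f \<longleftrightarrow>
     (\<forall>x. f differentiable (at x)) \<and> (\<forall>x. gradient f differentiable (at x))"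

(* The norm that the library puts on real ^ 'n ^ 'm is the Frobenius norm. *)
definition spectral_norm :: "real ^ 'n ^ 'm \<Rightarrow> real" where
  "spectral_norm A = onorm ((*v) A)"

definition hessian_lipschitz :: "real \<Rightarrow> (real ^ 'n \<Rightarrow> real) \<Rightarrow> bool" where
  "hessian_lipschitz L f \<longleftrightarrow>
     (\<forall>x y. spectral_norm (hessian f x - hessian f y) \<le> L * norm (x - y))"

(* The least Lipschitz constant. It is meaningful only if some constant exists. *)
definition hessian_lipschitz_const :: "(real ^ 'n \<Rightarrow> real) \<Rightarrow> real" where
  "hessian_lipschitz_const f = Inf {L. hessian_lipschitz L f}"

(* A partition of the coordinates into blocks 1, ..., B is a labelling blk with range {1..B};
   block b consists of the coordinates labelled b. As the dimension of a block depends on b, a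
   block vector is represented by its extension by zero to all coordinates. *)
definition block_space :: "('n \<Rightarrow> nat) \<Rightarrow> nat \<Rightarrow> (real ^ 'n) set" where
  "block_space blk b = {s. \<forall>i. blk i \<noteq> b \<longrightarrow> s $ i = 0}"

definition block_proj :: "('n \<Rightarrow> nat) \<Rightarrow> nat \<Rightarrow> real ^ 'n \<Rightarrow> real ^ 'n" where
  "block_proj blk b s = (\<chi> i. if blk i = b then s $ i else 0)"

(* The function f_b(s) = f(theta_1, ..., theta_b + s, ..., theta_B). It reads only the block b
   coordinates of its argument, so its gradient and Hessian are those of the function of the
   block variable alone, padded by zeros; the padding changes neither inner products with block
   vectors nor spectral norms, and hence not the Lipschitz constant of the Hessian. *)
definition block_restriction ::
    "(real ^ 'n \<Rightarrow> real) \<Rightarrow> ('n \<Rightarrow> nat) \<Rightarrow> nat \<Rightarrow> real ^ 'n \<Rightarrow> real ^ 'n \<Rightarrow> real" where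
  "block_restriction f blk b \<theta> s = f (\<theta> + block_proj blk b s)"

definition cubic_model :: "real ^ 'n \<Rightarrow> real ^ 'n ^ 'n \<Rightarrow> real \<Rightarrow> real ^ 'n \<Rightarrow> real" where
  "cubic_model g H M s = g \<bullet> s + 1 / 2 * ((H *v s) \<bullet> s) + M / 6 * norm s ^ 3"

definition block_model ::
    "(real ^ 'n \<Rightarrow> real) \<Rightarrow> ('n \<Rightarrow> nat) \<Rightarrow> nat \<Rightarrow> real ^ 'n \<Rightarrow> real \<Rightarrow> real ^ 'n \<Rightarrow> real" where
  "block_model f blk b \<theta> M =
     cubic_model (gradient (block_restriction f blk b \<theta>) 0)
       (hessian (block_restriction f blk b \<theta>) 0) M"

(* In iteration k, theta k b is the current point when block b is about to be processed, s k b
   the trial step and M k b the cubic weight. The acceptance flag is only required to imply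
   that f does not increase; taking it equivalent to that condition is a special case. *)
definition blockwise_cubic_iteration ::
    "(real ^ 'n \<Rightarrow> real) \<Rightarrow> ('n \<Rightarrow> nat) \<Rightarrow> nat \<Rightarrow> (nat \<Rightarrow> nat \<Rightarrow> real) \<Rightarrow>
     (nat \<Rightarrow> nat \<Rightarrow> real ^ 'n) \<Rightarrow> (nat \<Rightarrow> nat \<Rightarrow> bool) \<Rightarrow> (nat \<Rightarrow> nat \<Rightarrow> real ^ 'n) \<Rightarrow>
     (nat \<Rightarrow> real ^ 'n) \<Rightarrow> bool" where
  "blockwise_cubic_iteration f blk B M s accepted \<theta> x \<longleftrightarrow>
     (\<forall>k. \<theta> k 1 = x k \<and> x (Suc k) = \<theta> k (Suc B) \<and>
       (\<forall>b\<in>{1..B}.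
          M k b > 0 \<and>
          is_arg_min (block_model f blk b (\<theta> k b) (M k b)) (\<lambda>t. t \<in> block_space blk b) (s k b) \<and>
          (accepted k b \<longrightarrow> f (\<theta> k b + s k b) \<le> f (\<theta> k b)) \<and>
          \<theta> k (Suc b) = (if accepted k b then \<theta> k b + s k b else \<theta> k b)))"

end

theory Submission
  imports Defs
begin

text \<open>
  The cubic model along the line through the minimizer \<open>s\<close> is
  \<open>m(t s) = a t + h t\<^sup>2 / 2 + c t\<^sup>3\<close> for \<open>t \<ge> 0\<close>, where \<open>a = \<langle>g, s\<rangle>\<close>, \<open>h = \<langle>H s, s\<rangle>\<close> and
  \<open>c = M \<parallel>s\<parallel>\<^sup>3 / 6\<close>. Stationarity at \<open>t = 1\<close> gives \<open>a + h + 3 c = 0\<close>, and comparison with \<open>t = - 1\<close>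
  gives \<open>a \<le> 0\<close>. Together they yield \<open>h \<ge> - 3 c\<close>, hence \<open>m(s) = - h / 2 - 2 c \<le> - c / 2\<close>. The bound on
  \<open>f\<^sub>b\<close> follows by Taylor's inequality \<open>f\<^sub>b(s) \<le> f\<^sub>b(0) + m(s)\<close>, which needs the Hessian of \<open>f\<^sub>b\<close> to
  be Lipschitz with its least Lipschitz constant. That constant is attained as soon as some
  constant exists, and \<open>L\<^sub>H\<close> is one.
\<close>

section \<open>Gradients, Hessians and spectral norms\<close>

lemma gradient_eqI: "GDERIV f x :> g \<Longrightarrow> gradient f x = g"
proof -
  have "g' = g" if "GDERIV f x :> g" "GDERIV f x :> g'" for g g'
  proof -
    have "(\<lambda>h. h \<bullet> g) = (\<lambda>h. h \<bullet> g')"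
      using that has_derivative_unique unfolding gderiv_def by blast
    then show ?thesis
      by (metis vector_eq_ldot)
  qed
  then show "GDERIV f x :> g \<Longrightarrow> gradient f x = g"
    unfolding gradient_def by blast
qed

text \<open>The derivative is a linear functional, and its adjoint applied to 1 represents it as an
  inner product; hence the definite description in \<open>gradient\<close> denotes that
  vector.\<close>

lemma has_derivative_gradient:
  assumes "f differentiable (at x)"
  shows "(f has_derivative (\<lambda>h. h \<bullet> gradient f x)) (at x)"
proof -
  obtain D where D: "(f has_derivative D) (at x)"
    using assms differentiable_def by blast
  have "D h = h \<bullet> adjoint D 1" for h
    using adjoint_works[OF has_derivative_linear[OF D], of h 1] by simp
  then have "D = (\<lambda>h. h \<bullet> adjoint D 1)"
    by (rule ext)
  then obtain g where "D = (\<lambda>h. h \<bullet> g)" ..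
  with D have g: "GDERIV f x :> g"
    by (simp add: gderiv_def)
  then have "gradient f x = g"
    by (rule gradient_eqI)
  with g show ?thesis
    by (simp add: gderiv_def)
qed

lemma has_derivative_hessian:
  assumes "gradient f differentiable (at x)"
  shows "(gradient f has_derivative (*v) (hessian f x)) (at x)"
  using assms unfolding hessian_def by (simp add: jacobian_works)

lemma norm_matrix_vector_le_spectral_norm:
  "norm (A *v v) \<le> spectral_norm A * norm v"
  unfolding spectral_norm_def by (rule onorm[OF matrix_vector_mul_bounded_linear])

lemma spectral_norm_le:
  "(\<And>v. norm (A *v v) \<le> c * norm v) \<Longrightarrow> spectral_norm A \<le> c"
  unfolding spectral_norm_def by (rule onorm_le)

lemma spectral_norm_nonneg: "0 \<le> spectral_norm A"
  unfolding spectral_norm_def by (rule onorm_pos_le[OF matrix_vector_mul_bounded_linear])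

section \<open>Lipschitz constants of the Hessian\<close>

lemma hessian_lipschitz_nonneg:
  fixes f :: "real ^ 'n \<Rightarrow> real"
  assumes "hessian_lipschitz L f"
  shows "0 \<le> L"
proof -
  \<comment> \<open>Two distinct points are compared: \<open>1\<close> is the all-ones vector, so
    \<open>norm (1 - 0)\<close> is positive and the sign of \<open>L\<close> can be read
    off.\<close>
  have "0 \<le> spectral_norm (hessian f 1 - hessian f 0)"
    by (rule spectral_norm_nonneg)
  also have "\<dots> \<le> L * norm (1 - 0 :: real ^ 'n)"
    using assms unfolding hessian_lipschitz_def by blast
  finally show ?thesis
    by (simp add: zero_le_mult_iff)
qed

text \<open>Each difference quotient is a lower bound of the set of admissible constants. This set
  contains \<open>L\<close>, so the quotient stays below the infimum.\<close>

lemma hessian_lipschitz_least_constant: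
  assumes "hessian_lipschitz L f"
  shows "hessian_lipschitz (hessian_lipschitz_const f) f"
  unfolding hessian_lipschitz_def
proof (intro allI)
  fix x y
  show "spectral_norm (hessian f x - hessian f y) \<le> hessian_lipschitz_const f * norm (x - y)"
  proof (cases "x = y")
    case True
    then show ?thesis
      using assms unfolding hessian_lipschitz_def by (metis diff_self norm_zero mult_zero_right)
  next
    case False
    have "spectral_norm (hessian f x - hessian f y) / norm (x - y) \<le> hessian_lipschitz_const f"
      unfolding hessian_lipschitz_const_def
      using assms False by (intro cInf_greatest) (auto simp: hessian_lipschitz_def divide_simps)
    with False show ?thesis
      by (simp add: divide_simps)
  qed
qed

lemma hessian_lipschitz_mono:
  assumes "hessian_lipschitz L f" "L \<le> M"
  shows "hessian_lipschitz M f"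
  using assms unfolding hessian_lipschitz_def by (meson mult_right_mono norm_ge_zero order_trans)

section \<open>Taylor's inequality with cubic remainder\<close>

text \<open>The bound on \<open>\<phi>''\<close> is integrated twice from 0, in the form of
  monotonicity: a function that vanishes at 0 and has nonnegative derivative is nonnegative to the
  right of 0.\<close>

lemma taylor_upper_bound_cubic:
  fixes \<phi> \<phi>' \<phi>'' :: "real \<Rightarrow> real"
  assumes \<phi>: "\<And>t. (\<phi> has_real_derivative \<phi>' t) (at t)"
    and \<phi>': "\<And>t. (\<phi>' has_real_derivative \<phi>'' t) (at t)"
    and bound: "\<And>t. 0 \<le> t \<Longrightarrow> \<phi>'' t \<le> \<phi>'' 0 + K * t"
  shows "\<phi> 1 \<le> \<phi> 0 + \<phi>' 0 + \<phi>'' 0 / 2 + K / 6"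
proof -
  \<comment> \<open>\<open>\<psi>\<close> is the cubic majorant minus \<open>\<phi>\<close>, and
    \<open>\<psi>'\<close> is its derivative; both vanish at 0.\<close>
  define \<psi>' where "\<psi>' t = \<phi>' 0 + \<phi>'' 0 * t + K / 2 * t^2 - \<phi>' t" for t
  define \<psi> where "\<psi> t = \<phi> 0 + \<phi>' 0 * t + \<phi>'' 0 / 2 * t^2 + K / 6 * t^3 - \<phi> t" for t
  have \<psi>'_deriv: "(\<psi>' has_real_derivative (\<phi>'' 0 + K * t - \<phi>'' t)) (at t)" for t
    unfolding \<psi>'_def by (auto intro!: derivative_eq_intros \<phi>')
  have \<psi>_deriv: "(\<psi> has_real_derivative \<psi>' t) (at t)" for t
    unfolding \<psi>_def \<psi>'_def by (auto intro!: derivative_eq_intros \<phi>)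
  have "\<psi>' 0 \<le> \<psi>' t" if "0 \<le> t" for t
  proof (rule DERIV_nonneg_imp_nondecreasing[where f = \<psi>', OF that])
    show "\<exists>y. (\<psi>' has_real_derivative y) (at u) \<and> 0 \<le> y" if "0 \<le> u" for u
      using bound[OF that] by (intro exI[of _ "\<phi>'' 0 + K * u - \<phi>'' u"] conjI \<psi>'_deriv) simp
  qed
  then have nonneg: "0 \<le> \<psi>' t" if "0 \<le> t" for t
    using that by (simp add: \<psi>'_def)
  have "\<psi> 0 \<le> \<psi> 1"
  proof (rule DERIV_nonneg_imp_nondecreasing[where f = \<psi>])
    show "\<exists>y. (\<psi> has_real_derivative y) (at u) \<and> 0 \<le> y" if "0 \<le> u" for u
      using \<psi>_deriv nonneg[OF that] by blast
  qed simp
  then show ?thesis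
    by (simp add: \<psi>_def)
qed

text \<open>The one-dimensional inequality is applied along the ray \<open>t *\<^sub>R v\<close>
  with \<open>K = M * norm v ^ 3\<close>: two factors \<open>norm v\<close> come from the quadratic
  form, the third and the factor \<open>t\<close> from the displacement.\<close>

lemma cubic_model_upper_bound:
  fixes f :: "real ^ 'n \<Rightarrow> real"
  assumes f: "twice_differentiable f" and lip: "hessian_lipschitz M f"
  shows "f v \<le> f 0 + cubic_model (gradient f 0) (hessian f 0) M v"
proof -
  define \<phi> where "\<phi> t = f (t *\<^sub>R v)" for t
  define \<phi>' where "\<phi>' t = gradient f (t *\<^sub>R v) \<bullet> v" for t
  define \<phi>'' where "\<phi>'' t = (hessian f (t *\<^sub>R v) *v v) \<bullet> v" for t
  have line: "((\<lambda>t. t *\<^sub>R v) has_derivative (\<lambda>h. h *\<^sub>R v)) (at t)" for t :: real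
    by (auto intro!: derivative_eq_intros)
  have "(\<phi> has_real_derivative \<phi>' t) (at t)" for t
  proof -
    have "f differentiable (at (t *\<^sub>R v))"
      using f unfolding twice_differentiable_def by blast
    from has_derivative_compose[OF line has_derivative_gradient[OF this]]
    have "(\<phi> has_derivative (\<lambda>h. h *\<^sub>R v \<bullet> gradient f (t *\<^sub>R v))) (at t)"
      unfolding \<phi>_def .
    moreover have "(\<lambda>h. h *\<^sub>R v \<bullet> gradient f (t *\<^sub>R v)) = (*) (\<phi>' t)"
      by (simp add: \<phi>'_def fun_eq_iff inner_commute)
    ultimately show ?thesis
      by (simp add: has_field_derivative_def)
  qed
  moreover have "(\<phi>' has_real_derivative \<phi>'' t) (at t)" for t
  proof -
    have "gradient f differentiable (at (t *\<^sub>R v))"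
      using f unfolding twice_differentiable_def by blast
    from has_derivative_inner_left[OF
        has_derivative_compose[OF line has_derivative_hessian[OF this]], of v]
    have "(\<phi>' has_derivative (\<lambda>h. (hessian f (t *\<^sub>R v) *v (h *\<^sub>R v)) \<bullet> v)) (at t)"
      unfolding \<phi>'_def .
    moreover have "(\<lambda>h. (hessian f (t *\<^sub>R v) *v (h *\<^sub>R v)) \<bullet> v) = (*) (\<phi>'' t)"
      by (simp add: \<phi>''_def fun_eq_iff matrix_vector_mult_scaleR)
    ultimately show ?thesis
      by (simp add: has_field_derivative_def)
  qed
  moreover have "\<phi>'' t \<le> \<phi>'' 0 + M * norm v ^ 3 * t" if "0 \<le> t" for t
  proof -
    let ?D = "hessian f (t *\<^sub>R v) - hessian f 0"
    have "\<phi>'' t - \<phi>'' 0 = (?D *v v) \<bullet> v"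
      by (simp add: \<phi>''_def matrix_vector_mult_diff_rdistrib inner_diff_left)
    also have "\<dots> \<le> norm (?D *v v) * norm v"
      by (rule norm_cauchy_schwarz)
    also have "\<dots> \<le> spectral_norm ?D * norm v * norm v"
      by (intro mult_right_mono norm_matrix_vector_le_spectral_norm norm_ge_zero)
    also have "\<dots> \<le> M * norm (t *\<^sub>R v - 0) * norm v * norm v"
      using lip unfolding hessian_lipschitz_def by (intro mult_right_mono norm_ge_zero) blast
    also have "\<dots> = M * norm v ^ 3 * t"
      using that by (simp add: power3_eq_cube)
    finally show ?thesis
      by simp
  qed
  ultimately have "\<phi> 1 \<le> \<phi> 0 + \<phi>' 0 + \<phi>'' 0 / 2 + M * norm v ^ 3 / 6"
    by (rule taylor_upper_bound_cubic)
  then show ?thesis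
    by (simp add: \<phi>_def \<phi>'_def \<phi>''_def cubic_model_def)
qed

section \<open>Decrease of the cubic model at a minimizer\<close>

text \<open>Minimality is assumed only along the line through \<open>v\<close>, so the bound applies
  to a minimizer over any subspace, in particular over a block.\<close>

lemma cubic_model_minimizer_decrease:
  fixes v :: "real ^ 'n"
  assumes min: "\<And>t. cubic_model g H M v \<le> cubic_model g H M (t *\<^sub>R v)"
  shows "cubic_model g H M v \<le> - (M / 12) * norm v ^ 3"
proof -
  define a h c where "a = g \<bullet> v" and "h = (H *v v) \<bullet> v" and "c = M / 6 * norm v ^ 3"
  have model: "cubic_model g H M (t *\<^sub>R v) = a * t + h / 2 * t^2 + c * \<bar>t\<bar>^3" for t
    by (simp add: cubic_model_def a_def h_def c_def matrix_vector_mult_scaleR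
        power_mult_distrib power2_eq_square algebra_simps)
  have "((\<lambda>t. a * t + h / 2 * t^2 + c * t^3) has_real_derivative a + h + 3 * c) (at 1)"
    by (auto intro!: derivative_eq_intros)
  then have stationary: "a + h + 3 * c = 0"
  \<comment> \<open>Radius 1 confines \<open>t\<close> to the interval from 0 to 2, where
    \<open>\<bar>t\<bar> = t\<close> and the model agrees with the polynomial.\<close>
  proof (rule DERIV_local_min[where d = 1])
    show "\<forall>t. \<bar>1 - t\<bar> < 1 \<longrightarrow> a * 1 + h / 2 * 1^2 + c * 1^3 \<le> a * t + h / 2 * t^2 + c * t^3"
    proof (intro allI impI)
      fix t :: real
      assume "\<bar>1 - t\<bar> < 1"
      then have "\<bar>t\<bar> = t"
        by simp
      with min[of t] model[of t] model[of 1]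
      show "a * 1 + h / 2 * 1^2 + c * 1^3 \<le> a * t + h / 2 * t^2 + c * t^3"
        by simp
    qed
  qed simp
  \<comment> \<open>The quadratic and cubic terms agree at \<open>t = 1\<close> and
    \<open>t = - 1\<close>, which leaves \<open>a \<le> - a\<close>.\<close>
  have "a \<le> 0"
    using min[of "- 1"] model[of 1] model[of "- 1"] by simp
  moreover have "cubic_model g H M v = a + h / 2 + c"
    using model[of 1] by simp
  \<comment> \<open>Eliminating \<open>h\<close> by stationarity turns the value into
    \<open>a / 2 - c / 2\<close>.\<close>
  ultimately have "cubic_model g H M v \<le> - (c / 2)"
    using stationary by linarith
  then show ?thesis
    by (simp add: c_def)
qed

section \<open>Derivatives of block restrictions\<close>

lemma linear_block_proj: "linear (block_proj blk b)"
  by (rule linearI) (auto simp: block_proj_def vec_eq_iff)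

lemma norm_block_proj_le: "norm (block_proj blk b v) \<le> norm v"
  by (rule norm_le_componentwise_cart) (simp add: block_proj_def)

text \<open>The projection is diagonal with entries 0 and 1, hence self-adjoint. This moves it from
  the direction of differentiation onto the gradient.\<close>

lemma inner_block_proj_left: "block_proj blk b u \<bullet> v = u \<bullet> block_proj blk b v"
  by (auto simp: block_proj_def inner_vec_def intro!: sum.cong)

lemma scaleR_in_block_space: "v \<in> block_space blk b \<Longrightarrow> t *\<^sub>R v \<in> block_space blk b"
  by (simp add: block_space_def)

lemma has_derivative_block_shift:
  fixes \<theta> :: "real ^ 'n"
  shows "((\<lambda>v. \<theta> + block_proj blk b v) has_derivative block_proj blk b) (at v)"
  using linear_imp_has_derivative[OF linear_block_proj]
  by (auto intro!: derivative_eq_intros)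

lemma GDERIV_block_restriction:
  assumes "twice_differentiable f"
  shows "GDERIV (block_restriction f blk b \<theta>) v :>
    block_proj blk b (gradient f (\<theta> + block_proj blk b v))"
  using has_derivative_compose[OF has_derivative_block_shift
      has_derivative_gradient[of f "\<theta> + block_proj blk b v"]] assms
  unfolding twice_differentiable_def gderiv_def block_restriction_def
  by (simp add: inner_block_proj_left)

lemma gradient_block_restriction:
  assumes "twice_differentiable f"
  shows "gradient (block_restriction f blk b \<theta>) =
    (\<lambda>v. block_proj blk b (gradient f (\<theta> + block_proj blk b v)))"
  using gradient_eqI[OF GDERIV_block_restriction[OF assms]] by blast

lemma has_derivative_gradient_block_restriction:
  assumes "twice_differentiable f"
  shows "(gradient (block_restriction f blk b \<theta>) has_derivative
    (\<lambda>h. block_proj blk b (hessian f (\<theta> + block_proj blk b v) *v block_proj blk b h))) (at v)"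
proof -
  have "((\<lambda>v. gradient f (\<theta> + block_proj blk b v)) has_derivative
      (\<lambda>h. hessian f (\<theta> + block_proj blk b v) *v block_proj blk b h)) (at v)"
    using has_derivative_compose[OF has_derivative_block_shift has_derivative_hessian] assms
    unfolding twice_differentiable_def by blast
  from has_derivative_compose[OF this linear_imp_has_derivative[OF linear_block_proj]]
  show ?thesis
    unfolding gradient_block_restriction[OF assms] .
qed

lemma twice_differentiable_block_restriction:
  assumes "twice_differentiable f"
  shows "twice_differentiable (block_restriction f blk b \<theta>)"
  unfolding twice_differentiable_def differentiable_def
proof (intro conjI allI exI)
  show "(block_restriction f blk b \<theta> has_derivative
      (\<lambda>h. h \<bullet> block_proj blk b (gradient f (\<theta> + block_proj blk b v)))) (at v)" for v
    using GDERIV_block_restriction[OF assms] unfolding gderiv_def .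
qed (rule has_derivative_gradient_block_restriction[OF assms])

text \<open>Uniqueness of the derivative identifies the Hessian with the compression of the full
  Hessian by the projection. Describing its action on vectors spares a matrix for
  \<open>block_proj\<close>.\<close>

lemma hessian_block_restriction_mult:
  assumes "twice_differentiable f"
  shows "hessian (block_restriction f blk b \<theta>) v *v h =
    block_proj blk b (hessian f (\<theta> + block_proj blk b v) *v block_proj blk b h)"
proof -
  have "gradient (block_restriction f blk b \<theta>) differentiable (at v)"
    using twice_differentiable_block_restriction[OF assms] unfolding twice_differentiable_def
    by blast
  from has_derivative_unique[OF has_derivative_hessian[OF this]
      has_derivative_gradient_block_restriction[OF assms]]
  show ?thesis
    by (rule fun_cong)
qed

text \<open>A difference of block Hessians is a compression of a difference of full Hessians. The
  projection does not increase norms, which is used on the image, on the direction \<open>h\<close>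
  and, with \<open>L\<close> nonnegative, on the displacement \<open>u - v\<close>.\<close>

lemma hessian_lipschitz_block_restriction:
  assumes f: "twice_differentiable f" and lip: "hessian_lipschitz L f"
  shows "hessian_lipschitz L (block_restriction f blk b \<theta>)"
  unfolding hessian_lipschitz_def
proof (intro allI spectral_norm_le)
  fix u v h
  let ?P = "block_proj blk b" and ?F = "block_restriction f blk b \<theta>"
  let ?D = "hessian f (\<theta> + ?P u) - hessian f (\<theta> + ?P v)"
  have "(hessian ?F u - hessian ?F v) *v h = ?P (?D *v ?P h)"
    by (simp add: hessian_block_restriction_mult[OF f] matrix_vector_mult_diff_rdistrib
        linear_diff[OF linear_block_proj])
  then have "norm ((hessian ?F u - hessian ?F v) *v h) \<le> norm (?D *v ?P h)"
    by (simp add: norm_block_proj_le)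
  also have "\<dots> \<le> spectral_norm ?D * norm (?P h)"
    by (rule norm_matrix_vector_le_spectral_norm)
  also have "\<dots> \<le> spectral_norm ?D * norm h"
    by (intro mult_left_mono norm_block_proj_le spectral_norm_nonneg)
  also have "\<dots> \<le> L * norm ((\<theta> + ?P u) - (\<theta> + ?P v)) * norm h"
    using lip unfolding hessian_lipschitz_def by (intro mult_right_mono norm_ge_zero) blast
  also have "\<dots> = L * norm (?P (u - v)) * norm h"
    by (simp add: linear_diff[OF linear_block_proj])
  also have "\<dots> \<le> L * norm (u - v) * norm h"
    by (intro mult_right_mono mult_left_mono norm_block_proj_le norm_ge_zero
        hessian_lipschitz_nonneg[OF lip])
  finally show "norm ((hessian ?F u - hessian ?F v) *v h) \<le> L * norm (u - v) * norm h" .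
qed

section \<open>The blockwise iteration\<close>

lemma blockwise_cubic_iteration_step:
  assumes iter: "blockwise_cubic_iteration f blk B M s accepted \<theta> x" and b: "b \<in> {1..B}"
  shows "is_arg_min (block_model f blk b (\<theta> k b) (M k b)) (\<lambda>t. t \<in> block_space blk b) (s k b)"
    and "accepted k b \<longrightarrow> f (\<theta> k b + s k b) \<le> f (\<theta> k b)"
    and "\<theta> k (Suc b) = (if accepted k b then \<theta> k b + s k b else \<theta> k b)"
proof -
  note step = iter[unfolded blockwise_cubic_iteration_def, THEN spec, of k,
      THEN conjunct2, THEN conjunct2, THEN bspec, OF b]
  from step show "is_arg_min (block_model f blk b (\<theta> k b) (M k b))
      (\<lambda>t. t \<in> block_space blk b) (s k b)"
    by (elim conjE)
  from step show "accepted k b \<longrightarrow> f (\<theta> k b + s k b) \<le> f (\<theta> k b)"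
    by (elim conjE)
  from step show "\<theta> k (Suc b) = (if accepted k b then \<theta> k b + s k b else \<theta> k b)"
    by (elim conjE)
qed

lemma blockwise_cubic_iteration_endpoints:
  assumes "blockwise_cubic_iteration f blk B M s accepted \<theta> x"
  shows "\<theta> k 1 = x k" and "x (Suc k) = \<theta> k (Suc B)"
proof -
  note iter = assms[unfolded blockwise_cubic_iteration_def, THEN spec, of k]
  show "\<theta> k 1 = x k"
    by (rule iter[THEN conjunct1])
  show "x (Suc k) = \<theta> k (Suc B)"
    by (rule iter[THEN conjunct2, THEN conjunct1])
qed

lemma blockwise_cubic_iteration_monotone:
  assumes iter: "blockwise_cubic_iteration f blk B M s accepted \<theta> x"
  shows "f (x (Suc k)) \<le> f (x k)"
proof -
  have step: "f (\<theta> k (Suc b)) \<le> f (\<theta> k b)" if "b \<in> {1..B}" for b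
    using blockwise_cubic_iteration_step(2,3)[OF iter that, of k] by simp
  \<comment> \<open>\<open>\<theta> k (Suc b)\<close> is the point after \<open>b\<close> processed
    blocks, so the induction starts with equality at \<open>b = 0\<close> and reaches the next
    iterate at \<open>b = B\<close>.\<close>
  have "b \<le> B \<Longrightarrow> f (\<theta> k (Suc b)) \<le> f (\<theta> k 1)" for b
  proof (induction b)
    case (Suc b)
    then show ?case
      using step[of "Suc b"] by simp
  qed simp
  then have "f (\<theta> k (Suc B)) \<le> f (\<theta> k 1)"
    by blast
  then show ?thesis
    by (simp only: blockwise_cubic_iteration_endpoints[OF iter])
qed

theorem proposition3p14:
  fixes f :: "real ^ 'n \<Rightarrow> real" and L\<^sub>H :: real
    and blk :: "'n \<Rightarrow> nat" and B :: nat
    and M :: "nat \<Rightarrow> nat \<Rightarrow> real" and s :: "nat \<Rightarrow> nat \<Rightarrow> real ^ 'n"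
    and accepted :: "nat \<Rightarrow> nat \<Rightarrow> bool"
    and \<theta> :: "nat \<Rightarrow> nat \<Rightarrow> real ^ 'n" and x :: "nat \<Rightarrow> real ^ 'n"
  assumes "twice_differentiable f"
    and "hessian_lipschitz L\<^sub>H f"
    and "range blk = {1..B}"
    and "blockwise_cubic_iteration f blk B M s accepted \<theta> x"
  shows "(\<forall>k. f (x (Suc k)) \<le> f (x k)) \<and>
    (\<forall>k. \<forall>b\<in>{1..B}.
       accepted k b \<and> M k b \<ge> hessian_lipschitz_const (block_restriction f blk b (\<theta> k b)) \<longrightarrow>
         block_model f blk b (\<theta> k b) (M k b) (s k b) \<le> - (M k b / 12) * norm (s k b) ^ 3 \<and>
         block_restriction f blk b (\<theta> k b) (s k b)
           \<le> block_restriction f blk b (\<theta> k b) 0 - M k b / 12 * norm (s k b) ^ 3)"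
proof (intro conjI allI ballI impI)
  show "f (x (Suc k)) \<le> f (x k)" for k
    using assms(4) by (rule blockwise_cubic_iteration_monotone)
next
  fix k b
  assume b: "b \<in> {1..B}"
    and step: "accepted k b \<and> M k b \<ge> hessian_lipschitz_const (block_restriction f blk b (\<theta> k b))"
  let ?F = "block_restriction f blk b (\<theta> k b)"
    and ?m = "block_model f blk b (\<theta> k b) (M k b)"
  have "is_arg_min ?m (\<lambda>t. t \<in> block_space blk b) (s k b)"
    using assms(4) b by (rule blockwise_cubic_iteration_step)
  \<comment> \<open>The block space is closed under scaling, so every multiple of the step is a
    competitor.\<close>
  then have "?m (s k b) \<le> ?m (t *\<^sub>R s k b)" for t
    by (simp add: is_arg_min_linorder scaleR_in_block_space)
  then show decrease: "?m (s k b) \<le> - (M k b / 12) * norm (s k b) ^ 3"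
    unfolding block_model_def by (rule cubic_model_minimizer_decrease)
  \<comment> \<open>\<open>L\<^sub>H\<close> is admissible for the block restriction, so the least
    constant is itself admissible and can be enlarged to \<open>M k b\<close>.\<close>
  have "hessian_lipschitz (M k b) ?F"
    using hessian_lipschitz_least_constant[OF
        hessian_lipschitz_block_restriction[OF assms(1,2)]] step
    by (blast intro: hessian_lipschitz_mono)
  then have "?F (s k b) \<le> ?F 0 + ?m (s k b)"
    unfolding block_model_def
    by (rule cubic_model_upper_bound[OF twice_differentiable_block_restriction[OF assms(1)]])
  with decrease show "?F (s k b) \<le> ?F 0 - M k b / 12 * norm (s k b) ^ 3"
    by linarith
qed

end
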